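(* Let $F$ be a field of characteristic zero, let $V$ be the reflection representation over $F$ of the Weyl group $W$ of type $Y_{a,b,c}$ ($a,b,c\ge1$, $n=a+b+c+1$), and assume that the bilinear form $B$ on $V$ is nondegenerate. (i) For any $v\in V\otimes V$, we have $\widetilde{B}(\omega,v)=B(v)$. (ii) The Virasoro element $\omega$ is independent of the choice of basis $\Pi$ (i.e. for any basis $(b_i)$ of $V$ with dual basis $(b_i^* )$, defined by $B(b_i^*,b_j)=\delta_{ij}$, we have $\omega=\sum_i b_i^*\otimes b_i$). (iii) The Virasoro element $\omega$ is symmetric, meaning that $\tau(\omega)=\omega$, and $\omega=\frac12\sum_{i=1}^n\alpha_i^*\vee\alpha_i$. (iv) The Virasoro element $\omega$ is fixed by the action of any $w\in W$. (v) We have $\widetilde{B}(\omega,\omega)=n$, and $\omega\in S^2(V)\setminus M$.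
   Context: $Y_{a,b,c}$ ($a,b,c\ge1$) is the tree with $n=a+b+c+1$ vertices consisting of three paths with $a$, $b$ and $c$ vertices, each joined by one of its endpoints to a common trivalent branch vertex. Its Cartan matrix $A$ has $A_{ii}=2$, $A_{ij}=-1$ if $i,j$ are adjacent, and $A_{ij}=0$ otherwise. $W$ is the group generated by $s_1,\dots,s_n$ subject to $s_i^2=1$, $s_is_j=s_js_i$ if $A_{ij}=0$, and $s_is_js_i=s_js_is_j$ if $A_{ij}=-1$. $V$ is the $F$-vector space with basis the simple roots $\Pi=\{\alpha_1,\dots,\alpha_n\}$, with symmetric bilinear form $B(\alpha_i,\alpha_j)=A_{ij}$, on which $W$ acts by $s_i(v)=v-B(\alpha_i,v)\alpha_i$; $W$ acts diagonally on $V\otimes V$. $B$ is also regarded as the linear map $V\otimes V\to F$, $v\otimes v'\mapsto B(v,v')$. Put $\alpha\vee\beta=\alpha\otimes\beta+\beta\otimes\alpha$; $\tau$ is the linear map on $V\otimes V$ with $\tau(u\otimes v)=v\otimes u$; $S^2(V)$ is the $1$-eigenspace of $\tau$; $M=\{v\in S^2(V):B(v)=0\}$. $\widetilde{B}$ is the bilinear form on $V\otimes V$ with $\widetilde{B}(u\otimes v,u'\otimes v')=B(u,u')B(v,v')$. When $B$ is nondegenerate, $\alpha_i^*\in V$ are defined by $B(\alpha_i^*,\alpha_j)=\delta_{ij}$, and the Virasoro element is $\omega=\sum_{i=1}^n\alpha_i^*\otimes\alpha_i$. *)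

theory Defs
  imports Complex_Main "HOL-Library.Function_Algebras" "HOL-Algebra.Generated_Groups"
begin

section \<open>The tree and its Cartan matrix\<close>

text \<open>
  The vertices are 1, ..., n with n = a + b + c + 1; the arms are three blocks of consecutive
  integers, and n is the branch vertex, joined to the least element of each arm.
\<close>

definition Y_arms :: "nat \<Rightarrow> nat \<Rightarrow> nat \<Rightarrow> nat set set" where
  "Y_arms a b c = {{1..a}, {a + 1..a + b}, {a + b + 1..a + b + c}}"

definition Y_adjacent :: "nat \<Rightarrow> nat \<Rightarrow> nat \<Rightarrow> nat \<Rightarrow> nat \<Rightarrow> bool" where
  "Y_adjacent a b c i j \<longleftrightarrow>
     (\<exists>P \<in> Y_arms a b c.
        (i \<in> P \<and> j \<in> P \<and> (j = i + 1 \<or> i = j + 1)) \<or>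
        (i = a + b + c + 1 \<and> j = Min P) \<or>
        (j = a + b + c + 1 \<and> i = Min P))"

definition Y_cartan :: "nat \<Rightarrow> nat \<Rightarrow> nat \<Rightarrow> nat \<Rightarrow> nat \<Rightarrow> int" where
  "Y_cartan a b c i j = (if i = j then 2 else if Y_adjacent a b c i j then -1 else 0)"

lemma Y_cartan_diag: "Y_cartan a b c i i = 2"
  by (simp add: Y_cartan_def)

lemma Y_cartan_sym: "Y_cartan a b c i j = Y_cartan a b c j i"
  by (auto simp: Y_cartan_def Y_adjacent_def)


section \<open>The Weyl group\<close>

text \<open>
  The group presented by generators s(1), ..., s(n) and the relations below. As the
  generators are involutions, every element is represented by a word without inverses, so
  the group is the set of words modulo the congruence generated by the relations. The lemmas
  \<open>weyl_group_is_group\<close>, \<open>weyl_group_relations\<close>, \<open>weyl_group_generated\<close> and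
  \<open>weyl_group_universal\<close> show that this is the presented group.
\<close>

inductive weyl_eq :: "nat \<Rightarrow> (nat \<Rightarrow> nat \<Rightarrow> int) \<Rightarrow> nat list \<Rightarrow> nat list \<Rightarrow> bool"
  for n A where
  weyl_refl: "u \<in> lists {1..n} \<Longrightarrow> weyl_eq n A u u"
| weyl_sym: "weyl_eq n A u v \<Longrightarrow> weyl_eq n A v u"
| weyl_trans: "weyl_eq n A u v \<Longrightarrow> weyl_eq n A v w \<Longrightarrow> weyl_eq n A u w"
| weyl_append: "weyl_eq n A u u' \<Longrightarrow> weyl_eq n A v v' \<Longrightarrow> weyl_eq n A (u @ v) (u' @ v')"
| weyl_square: "i \<in> {1..n} \<Longrightarrow> weyl_eq n A [i, i] []"
| weyl_commute: "i \<in> {1..n} \<Longrightarrow> j \<in> {1..n} \<Longrightarrow> A i j = 0 \<Longrightarrow> weyl_eq n A [i, j] [j, i]"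
| weyl_braid: "i \<in> {1..n} \<Longrightarrow> j \<in> {1..n} \<Longrightarrow> A i j = -1 \<Longrightarrow> weyl_eq n A [i, j, i] [j, i, j]"

definition weyl_class :: "nat \<Rightarrow> (nat \<Rightarrow> nat \<Rightarrow> int) \<Rightarrow> nat list \<Rightarrow> nat list set" where
  "weyl_class n A u = {v. weyl_eq n A u v}"

definition weyl_group :: "nat \<Rightarrow> (nat \<Rightarrow> nat \<Rightarrow> int) \<Rightarrow> nat list set monoid" where
  "weyl_group n A =
     \<lparr>carrier = weyl_class n A ` lists {1..n},
      mult = (\<lambda>X Y. weyl_class n A ((SOME u. u \<in> X) @ (SOME v. v \<in> Y))),
      one = weyl_class n A []\<rparr>"

lemma weyl_eq_lists:
  "weyl_eq n A u v \<Longrightarrow> u \<in> lists {1..n} \<and> v \<in> lists {1..n}"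
  by (induction rule: weyl_eq.induct) auto

lemma weyl_class_eq_iff:
  assumes "u \<in> lists {1..n}" "v \<in> lists {1..n}"
  shows "weyl_class n A u = weyl_class n A v \<longleftrightarrow> weyl_eq n A u v"
proof
  assume "weyl_class n A u = weyl_class n A v"
  then show "weyl_eq n A u v"
    using weyl_refl[OF assms(2)] unfolding weyl_class_def by blast
next
  assume "weyl_eq n A u v"
  then show "weyl_class n A u = weyl_class n A v"
    unfolding weyl_class_def by (blast intro: weyl_sym weyl_trans)
qed

lemma weyl_class_rep:
  assumes "u \<in> lists {1..n}"
  shows "weyl_eq n A u (SOME v. v \<in> weyl_class n A u)"
proof -
  have "u \<in> weyl_class n A u"
    using weyl_refl[OF assms] by (simp add: weyl_class_def)
  then have "(SOME v. v \<in> weyl_class n A u) \<in> weyl_class n A u"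
    by (rule someI)
  then show ?thesis by (simp add: weyl_class_def)
qed

lemma weyl_group_mult:
  assumes "u \<in> lists {1..n}" "v \<in> lists {1..n}"
  shows "weyl_class n A u \<otimes>\<^bsub>weyl_group n A\<^esub> weyl_class n A v = weyl_class n A (u @ v)"
proof -
  have e: "weyl_eq n A (u @ v)
     ((SOME w. w \<in> weyl_class n A u) @ (SOME w. w \<in> weyl_class n A v))"
    by (intro weyl_append weyl_class_rep assms)
  show ?thesis
    using weyl_class_eq_iff[THEN iffD2, OF _ _ e] weyl_eq_lists[OF e]
    unfolding weyl_group_def by simp
qed

lemma weyl_group_carrier: "carrier (weyl_group n A) = weyl_class n A ` lists {1..n}"
  by (simp add: weyl_group_def)

lemma weyl_group_one: "\<one>\<^bsub>weyl_group n A\<^esub> = weyl_class n A []"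
  by (simp add: weyl_group_def)

lemma weyl_eq_rev_append:
  "u \<in> lists {1..n} \<Longrightarrow> weyl_eq n A (rev u @ u) []"
proof (induction u)
  case Nil
  then show ?case by (simp add: weyl_refl)
next
  case (Cons i u)
  then have i: "i \<in> {1..n}" and u: "u \<in> lists {1..n}" by auto
  then have ru: "rev u \<in> lists {1..n}" by auto
  have "weyl_eq n A (rev u @ ([i, i] @ u)) (rev u @ ([] @ u))"
    by (intro weyl_append weyl_refl ru u weyl_square i)
  then have "weyl_eq n A (rev (i # u) @ i # u) (rev u @ u)" by simp
  then show ?case using Cons.IH[OF u] by (rule weyl_trans)
qed

lemma weyl_group_is_group: "group (weyl_group n A)"
proof (rule groupI)
  fix x y z
  assume "x \<in> carrier (weyl_group n A)" "y \<in> carrier (weyl_group n A)"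
  then obtain u v where uv: "u \<in> lists {1..n}" "v \<in> lists {1..n}"
    and xy: "x = weyl_class n A u" "y = weyl_class n A v"
    by (auto simp: weyl_group_carrier)
  then have uv': "u @ v \<in> lists {1..n}" by auto
  show "x \<otimes>\<^bsub>weyl_group n A\<^esub> y \<in> carrier (weyl_group n A)"
    unfolding xy weyl_group_mult[OF uv] weyl_group_carrier using uv' by (rule imageI)
  assume "z \<in> carrier (weyl_group n A)"
  then obtain w where w: "w \<in> lists {1..n}" and z: "z = weyl_class n A w"
    by (auto simp: weyl_group_carrier)
  then have vw: "v @ w \<in> lists {1..n}" using uv by auto
  show "x \<otimes>\<^bsub>weyl_group n A\<^esub> y \<otimes>\<^bsub>weyl_group n A\<^esub> z =
        x \<otimes>\<^bsub>weyl_group n A\<^esub> (y \<otimes>\<^bsub>weyl_group n A\<^esub> z)"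
    unfolding xy z weyl_group_mult[OF uv] weyl_group_mult[OF uv(2) w]
      weyl_group_mult[OF uv' w] weyl_group_mult[OF uv(1) vw] by simp
next
  show "\<one>\<^bsub>weyl_group n A\<^esub> \<in> carrier (weyl_group n A)"
    by (auto simp: weyl_group_carrier weyl_group_one)
next
  fix x assume "x \<in> carrier (weyl_group n A)"
  then obtain u where u: "u \<in> lists {1..n}" and x: "x = weyl_class n A u"
    by (auto simp: weyl_group_carrier)
  have nil: "[] \<in> lists {1..n}" and ru: "rev u \<in> lists {1..n}"
    and ruu: "rev u @ u \<in> lists {1..n}" using u by auto
  show "\<one>\<^bsub>weyl_group n A\<^esub> \<otimes>\<^bsub>weyl_group n A\<^esub> x = x"
    unfolding weyl_group_one x weyl_group_mult[OF nil u] by simp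
  have "weyl_class n A (rev u) \<otimes>\<^bsub>weyl_group n A\<^esub> x = \<one>\<^bsub>weyl_group n A\<^esub>"
    unfolding weyl_group_one x weyl_group_mult[OF ru u]
    using weyl_eq_rev_append[OF u] weyl_class_eq_iff[OF ruu nil] by blast
  then show "\<exists>y\<in>carrier (weyl_group n A). y \<otimes>\<^bsub>weyl_group n A\<^esub> x = \<one>\<^bsub>weyl_group n A\<^esub>"
    using ru unfolding weyl_group_carrier by blast
qed

lemma weyl_group_relations:
  fixes n A
  defines "W \<equiv> weyl_group n A" and "s \<equiv> (\<lambda>i. weyl_class n A [i])"
  assumes i: "i \<in> {1..n}" and j: "j \<in> {1..n}"
  shows "s i \<otimes>\<^bsub>W\<^esub> s i = \<one>\<^bsub>W\<^esub>"
    and "A i j = 0 \<Longrightarrow> s i \<otimes>\<^bsub>W\<^esub> s j = s j \<otimes>\<^bsub>W\<^esub> s i"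
    and "A i j = -1 \<Longrightarrow> s i \<otimes>\<^bsub>W\<^esub> s j \<otimes>\<^bsub>W\<^esub> s i = s j \<otimes>\<^bsub>W\<^esub> s i \<otimes>\<^bsub>W\<^esub> s j"
proof -
  have l: "[i] \<in> lists {1..n}" "[j] \<in> lists {1..n}" "[i, j] \<in> lists {1..n}"
    "[j, i] \<in> lists {1..n}" "[i, i] \<in> lists {1..n}" "[] \<in> lists {1..n}"
    "[i, j, i] \<in> lists {1..n}" "[j, i, j] \<in> lists {1..n}"
    using i j by auto
  note m = weyl_group_mult[of _ n _ A]
  show "s i \<otimes>\<^bsub>W\<^esub> s i = \<one>\<^bsub>W\<^esub>"
    unfolding W_def s_def m[OF l(1,1)] weyl_group_one
    using weyl_square[OF i, of A] weyl_class_eq_iff[OF l(5,6)] by simp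
  show "s i \<otimes>\<^bsub>W\<^esub> s j = s j \<otimes>\<^bsub>W\<^esub> s i" if "A i j = 0"
    unfolding W_def s_def m[OF l(1,2)] m[OF l(2,1)]
    using weyl_commute[of i n j A, OF i j that] weyl_class_eq_iff[OF l(3,4)] by simp
  show "s i \<otimes>\<^bsub>W\<^esub> s j \<otimes>\<^bsub>W\<^esub> s i = s j \<otimes>\<^bsub>W\<^esub> s i \<otimes>\<^bsub>W\<^esub> s j" if "A i j = -1"
    unfolding W_def s_def m[OF l(1,2)] m[OF l(2,1)] append.simps m[OF l(3,1)] m[OF l(4,2)]
    using weyl_braid[of i n j A, OF i j that] weyl_class_eq_iff[OF l(7,8)] by simp
qed

lemma weyl_group_generated:
  "carrier (weyl_group n A) = generate (weyl_group n A) ((\<lambda>i. weyl_class n A [i]) ` {1..n})"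
    (is "_ = generate ?W ?S")
proof -
  interpret W: group ?W by (rule weyl_group_is_group)
  have S: "?S \<subseteq> carrier ?W" unfolding weyl_group_carrier by auto
  have "weyl_class n A u \<in> generate ?W ?S" if "u \<in> lists {1..n}" for u
    using that
  proof (induction u)
    case Nil
    then show ?case using generate.one[of ?W ?S] by (simp add: weyl_group_one)
  next
    case (Cons i u)
    then have i: "[i] \<in> lists {1..n}" and u: "u \<in> lists {1..n}" by auto
    have "weyl_class n A [i] \<in> generate ?W ?S" by (rule generate.incl) (use i in auto)
    from generate.eng[OF this Cons.IH] show ?case
      unfolding weyl_group_mult[OF i u] by simp
  qed
  then have "carrier ?W \<subseteq> generate ?W ?S"
    unfolding weyl_group_carrier by (rule image_subsetI)
  moreover have "generate ?W ?S \<subseteq> carrier ?W"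
    using W.generate_in_carrier[OF S] by (rule subsetI)
  ultimately show ?thesis by (rule equalityI)
qed

lemma weyl_group_universal:
  fixes G (structure)
  assumes G: "group G" and f: "f \<in> {1..n} \<rightarrow> carrier G"
    and square: "\<And>i. i \<in> {1..n} \<Longrightarrow> f i \<otimes> f i = \<one>"
    and commute: "\<And>i j. i \<in> {1..n} \<Longrightarrow> j \<in> {1..n} \<Longrightarrow> A i j = 0 \<Longrightarrow> f i \<otimes> f j = f j \<otimes> f i"
    and braid: "\<And>i j. i \<in> {1..n} \<Longrightarrow> j \<in> {1..n} \<Longrightarrow> A i j = -1 \<Longrightarrow>
                  f i \<otimes> f j \<otimes> f i = f j \<otimes> f i \<otimes> f j"
  shows "\<exists>h \<in> hom (weyl_group n A) G. \<forall>i\<in>{1..n}. h (weyl_class n A [i]) = f i"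
proof -
  interpret G: group G by (rule G)
  define g where "g u = foldr (\<lambda>i x. f i \<otimes> x) u \<one>" for u
  have g_in: "g u \<in> carrier G" if "u \<in> lists {1..n}" for u
    using that f by (induction u) (auto simp: g_def)
  have g_append: "g (u @ v) = g u \<otimes> g v" if "u \<in> lists {1..n}" "v \<in> lists {1..n}" for u v
    using that(1)
  proof (induction u)
    case Nil
    then show ?case using g_in[OF that(2)] by (simp add: g_def)
  next
    case (Cons i u)
    then have "f i \<in> carrier G" "u \<in> lists {1..n}" using f by auto
    then show ?case using Cons.IH g_in[of u] g_in[OF that(2)] by (simp add: g_def G.m_assoc)
  qed
  have g_eq: "g u = g v" if "weyl_eq n A u v" for u v
    using that
  proof (induction rule: weyl_eq.induct)
    case (weyl_append u u' v v')
    then show ?case using weyl_eq_lists[of n A] g_append by metis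
  next
    case (weyl_square i)
    then have "f i \<in> carrier G" using f by auto
    then show ?case using assms(3)[OF weyl_square] by (simp add: g_def)
  next
    case (weyl_commute i j)
    then have "f i \<in> carrier G" "f j \<in> carrier G" using f by auto
    then show ?case using assms(4)[OF weyl_commute] by (simp add: g_def)
  next
    case (weyl_braid i j)
    then have "f i \<in> carrier G" "f j \<in> carrier G" using f by auto
    then show ?case using assms(5)[OF weyl_braid] by (simp add: g_def G.m_assoc)
  qed auto
  define h where "h X = g (SOME u. u \<in> X)" for X
  have h: "h (weyl_class n A u) = g u" if "u \<in> lists {1..n}" for u
    unfolding h_def using g_eq[OF weyl_class_rep[OF that]] by simp
  have "h \<in> hom (weyl_group n A) G"
  proof (rule homI)
    fix x assume "x \<in> carrier (weyl_group n A)"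
    then show "h x \<in> carrier G" unfolding weyl_group_carrier
    proof (rule imageE)
      fix u assume x: "x = weyl_class n A u" and u: "u \<in> lists {1..n}"
      show ?thesis unfolding x h[OF u] by (rule g_in[OF u])
    qed
  next
    fix x y assume "x \<in> carrier (weyl_group n A)" "y \<in> carrier (weyl_group n A)"
    then obtain u v where uv: "u \<in> lists {1..n}" "v \<in> lists {1..n}"
      and xy: "x = weyl_class n A u" "y = weyl_class n A v"
      by (auto simp: weyl_group_carrier)
    then have uv': "u @ v \<in> lists {1..n}" by auto
    show "h (x \<otimes>\<^bsub>weyl_group n A\<^esub> y) = h x \<otimes> h y"
      unfolding xy weyl_group_mult[OF uv] h[OF uv'] h[OF uv(1)] h[OF uv(2)]
      by (rule g_append[OF uv])
  qed
  moreover have "h (weyl_class n A [i]) = f i" if i: "i \<in> {1..n}" for i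
  proof -
    have "f i \<in> carrier G" "[i] \<in> lists {1..n}" using i f by auto
    then show ?thesis using h[of "[i]"] by (simp add: g_def)
  qed
  ultimately show ?thesis by blast
qed


section \<open>The reflection representation\<close>

text \<open>
  The vector space with basis the simple roots is realised as the functions on the naturals
  vanishing outside 1, ..., n.
\<close>

definition fscale :: "'f::field \<Rightarrow> ('i \<Rightarrow> 'f) \<Rightarrow> 'i \<Rightarrow> 'f" where
  "fscale r v = (\<lambda>i. r * v i)"

interpretation fun_vs: vector_space "fscale :: 'f::field \<Rightarrow> ('i \<Rightarrow> 'f) \<Rightarrow> 'i \<Rightarrow> 'f"
  by unfold_locales (auto simp: fscale_def fun_eq_iff algebra_simps)

definition root_space :: "nat \<Rightarrow> (nat \<Rightarrow> 'f::field) set" where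
  "root_space n = {v. \<forall>i. i \<notin> {1..n} \<longrightarrow> v i = 0}"

definition simple_root :: "nat \<Rightarrow> nat \<Rightarrow> 'f::field" where
  "simple_root i = (\<lambda>j. if j = i then 1 else 0)"

definition root_form ::
    "nat \<Rightarrow> (nat \<Rightarrow> nat \<Rightarrow> int) \<Rightarrow> (nat \<Rightarrow> 'f::field) \<Rightarrow> (nat \<Rightarrow> 'f) \<Rightarrow> 'f" where
  "root_form n A u v = (\<Sum>i=1..n. \<Sum>j=1..n. u i * v j * of_int (A i j))"

definition nondegenerate ::
    "nat \<Rightarrow> ((nat \<Rightarrow> 'f::field) \<Rightarrow> (nat \<Rightarrow> 'f) \<Rightarrow> 'f) \<Rightarrow> bool" where
  "nondegenerate n B \<longleftrightarrow>
     (\<forall>u \<in> root_space n. (\<forall>v \<in> root_space n. B u v = 0) \<longrightarrow> u = 0)"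

definition reflection ::
    "nat \<Rightarrow> (nat \<Rightarrow> nat \<Rightarrow> int) \<Rightarrow> nat \<Rightarrow> (nat \<Rightarrow> 'f::field) \<Rightarrow> nat \<Rightarrow> 'f" where
  "reflection n A i v = v - fscale (root_form n A (simple_root i) v) (simple_root i)"

text \<open>
  A group element acts through any word representing it; the choice is immaterial by
  \<open>weyl_act_class\<close>.
\<close>

definition weyl_act ::
    "nat \<Rightarrow> (nat \<Rightarrow> nat \<Rightarrow> int) \<Rightarrow> nat list set \<Rightarrow> (nat \<Rightarrow> 'f::field) \<Rightarrow> nat \<Rightarrow> 'f" where
  "weyl_act n A w = foldr (reflection n A) (SOME u. u \<in> w)"

definition is_basis :: "nat \<Rightarrow> (nat \<Rightarrow> nat \<Rightarrow> 'f::field) \<Rightarrow> bool" where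
  "is_basis n b \<longleftrightarrow>
     inj_on b {1..n} \<and> fun_vs.independent (b ` {1..n}) \<and> fun_vs.span (b ` {1..n}) = root_space n"

definition dual_basis ::
    "nat \<Rightarrow> ((nat \<Rightarrow> 'f::field) \<Rightarrow> (nat \<Rightarrow> 'f) \<Rightarrow> 'f) \<Rightarrow> (nat \<Rightarrow> nat \<Rightarrow> 'f) \<Rightarrow> nat \<Rightarrow> nat \<Rightarrow> 'f"
  where
  "dual_basis n B b i =
     (THE x. x \<in> root_space n \<and> (\<forall>j\<in>{1..n}. B x (b j) = (if i = j then 1 else 0)))"

lemma sum_fun_apply: "(\<Sum>i\<in>I. f i) x = (\<Sum>i\<in>I. f i x)"
  by (induction I rule: infinite_finite_induct) auto

lemma root_space_expand:
  assumes "v \<in> root_space n"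
  shows "v = (\<Sum>i=1..n. fscale (v i) (simple_root i))"
proof
  fix j
  show "v j = (\<Sum>i=1..n. fscale (v i) (simple_root i)) j"
    using assms
    by (cases "j \<in> {1..n}")
       (auto simp: sum_fun_apply fscale_def simple_root_def root_space_def if_distrib
         sum.delta cong: if_cong)
qed

lemma simple_root_is_basis: "is_basis n (simple_root :: nat \<Rightarrow> nat \<Rightarrow> 'f::field)"
proof -
  let ?b = "simple_root :: nat \<Rightarrow> nat \<Rightarrow> 'f"
  have inj: "inj_on ?b {1..n}"
    by (rule inj_onI) (metis simple_root_def zero_neq_one)
  have ind: "fun_vs.independent (?b ` {1..n})"
  proof (rule fun_vs.independent_if_scalars_zero)
    fix f x assume s: "(\<Sum>x\<in>?b ` {1..n}. fscale (f x) x) = 0" and x: "x \<in> ?b ` {1..n}"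
    then obtain j where j: "j \<in> {1..n}" "x = ?b j" by auto
    have "(\<Sum>i\<in>{1..n}. fscale (f (?b i)) (?b i)) j = 0"
      using s sum.reindex[OF inj, of "\<lambda>x. fscale (f x) x"] by (simp add: o_def)
    then show "f x = 0"
      using j by (simp add: sum_fun_apply fscale_def simple_root_def if_distrib sum.delta
          cong: if_cong)
  qed simp
  have "fun_vs.subspace (root_space n :: (nat \<Rightarrow> 'f) set)"
    by (auto simp: fun_vs.subspace_def root_space_def fscale_def)
  then have "fun_vs.span (?b ` {1..n}) \<subseteq> root_space n"
    by (intro fun_vs.span_minimal) (auto simp: root_space_def simple_root_def)
  moreover have "v \<in> fun_vs.span (?b ` {1..n})" if "v \<in> root_space n" for v
    by (subst root_space_expand[OF that])
       (intro fun_vs.span_sum fun_vs.span_scale fun_vs.span_base imageI)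
  ultimately show ?thesis using inj ind unfolding is_basis_def by blast
qed

lemma root_form_simple_left:
  assumes "i \<in> {1..n}"
  shows "root_form n A (simple_root i) v = (\<Sum>k=1..n. v k * of_int (A i k))"
proof -
  have "root_form n A (simple_root i) v =
        (\<Sum>l=1..n. if l = i then (\<Sum>k=1..n. v k * of_int (A l k)) else 0)"
    unfolding root_form_def by (intro sum.cong) (auto simp: simple_root_def)
  then show ?thesis using assms by simp
qed

lemma root_form_simple_roots:
  "i \<in> {1..n} \<Longrightarrow> j \<in> {1..n} \<Longrightarrow> root_form n A (simple_root i) (simple_root j) = of_int (A i j)"
  unfolding root_form_simple_left
  by (simp add: simple_root_def if_distrib[of "\<lambda>x. x * _"] sum.delta cong: if_cong)

lemma root_form_minus_scale:
  "root_form n A w (u - fscale r v) = root_form n A w u - r * root_form n A w v"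
  by (simp add: root_form_def fscale_def algebra_simps sum_subtractf sum_distrib_left)

lemma weyl_act_class:
  assumes diag: "\<And>i. i \<in> {1..n} \<Longrightarrow> A i i = 2"
    and sym: "\<And>i j. i \<in> {1..n} \<Longrightarrow> j \<in> {1..n} \<Longrightarrow> A i j = A j i"
    and u: "u \<in> lists {1..n}"
  shows "weyl_act n A (weyl_class n A u) = foldr (reflection n A :: nat \<Rightarrow> (nat \<Rightarrow> 'f::field) \<Rightarrow> _) u"
proof -
  have eq: "foldr (reflection n A :: nat \<Rightarrow> (nat \<Rightarrow> 'f) \<Rightarrow> _) u = foldr (reflection n A) v"
    if "weyl_eq n A u v" for u v
    using that
  proof (induction rule: weyl_eq.induct)
    case (weyl_square i)
    note rs = root_form_simple_roots[OF weyl_square weyl_square, of A]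
    note ij = diag[OF weyl_square]
    show ?case
      unfolding foldr.simps comp_def id_apply reflection_def root_form_minus_scale rs ij
      by (intro ext) (simp add: fscale_def algebra_simps)
  next
    case (weyl_commute i j)
    then have ij: "A i j = 0" "A j i = 0" using sym by metis+
    note rs = root_form_simple_roots[OF weyl_commute(1,2), of A] root_form_simple_roots[OF weyl_commute(2,1), of A]
    show ?case
      unfolding foldr.simps comp_def id_apply reflection_def root_form_minus_scale rs ij
      by (intro ext) (simp add: fscale_def algebra_simps)
  next
    case (weyl_braid i j)
    then have ij: "A i j = -1" "A j i = -1" "A i i = 2" "A j j = 2" using sym diag by metis+
    note rs = root_form_simple_roots[OF weyl_braid(1,2), of A] root_form_simple_roots[OF weyl_braid(2,1), of A]
      root_form_simple_roots[OF weyl_braid(1,1), of A] root_form_simple_roots[OF weyl_braid(2,2), of A]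
    show ?case
      unfolding foldr.simps comp_def id_apply reflection_def root_form_minus_scale rs ij
      by (intro ext) (simp add: fscale_def algebra_simps)
  qed auto
  show ?thesis
    unfolding weyl_act_def using eq[OF weyl_class_rep[OF u, of A]] by simp
qed


section \<open>The tensor square\<close>

text \<open>
  The tensor square of the root space is realised as the functions supported on the square of
  the index set, with (u tensor v)(i, j) = u(i) v(j). The map \<open>tensor_lift n sc f\<close> is the
  linear map induced by a bilinear map \<open>f\<close> into a vector space with scalar
  multiplication \<open>sc\<close>; the universal property is \<open>tensor_lift_tensor\<close>,
  \<open>tensor_lift_linear\<close> and \<open>tensor_lift_unique\<close>.
\<close>

definition tensor_space :: "nat \<Rightarrow> (nat \<times> nat \<Rightarrow> 'f::field) set" where
  "tensor_space n = {t. \<forall>p. p \<notin> {1..n} \<times> {1..n} \<longrightarrow> t p = 0}"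

definition tensor :: "(nat \<Rightarrow> 'f::field) \<Rightarrow> (nat \<Rightarrow> 'f) \<Rightarrow> nat \<times> nat \<Rightarrow> 'f" where
  "tensor u v = (\<lambda>(i, j). u i * v j)"

definition vee :: "(nat \<Rightarrow> 'f::field) \<Rightarrow> (nat \<Rightarrow> 'f) \<Rightarrow> nat \<times> nat \<Rightarrow> 'f" where
  "vee u v = tensor u v + tensor v u"

definition tensor_lift ::
    "nat \<Rightarrow> ('f::field \<Rightarrow> 'x::ab_group_add \<Rightarrow> 'x) \<Rightarrow> ((nat \<Rightarrow> 'f) \<Rightarrow> (nat \<Rightarrow> 'f) \<Rightarrow> 'x) \<Rightarrow>
     (nat \<times> nat \<Rightarrow> 'f) \<Rightarrow> 'x" where
  "tensor_lift n sc f t =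
     (\<Sum>i=1..n. \<Sum>j=1..n. sc (t (i, j)) (f (simple_root i) (simple_root j)))"

lemma tensor_in_tensor_space:
  "u \<in> root_space n \<Longrightarrow> v \<in> root_space n \<Longrightarrow> tensor u v \<in> tensor_space n"
  by (auto simp: tensor_def root_space_def tensor_space_def)

lemma tensor_bilinear:
  "tensor (u + u') v = tensor u v + tensor u' v"
  "tensor u (v + v') = tensor u v + tensor u v'"
  "tensor (fscale r u) v = fscale r (tensor u v)"
  "tensor u (fscale r v) = fscale r (tensor u v)"
  by (auto simp: tensor_def fscale_def fun_eq_iff algebra_simps)

lemma tensor_space_expand:
  fixes t :: "nat \<times> nat \<Rightarrow> 'f::field"
  assumes "t \<in> tensor_space n"
  shows "t = (\<Sum>i=1..n. \<Sum>j=1..n. fscale (t (i, j)) (tensor (simple_root i) (simple_root j)))"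
    (is "_ = ?r")
proof
  fix p :: "nat \<times> nat"
  obtain k l where p: "p = (k, l)" by (cases p)
  have "?r p = (\<Sum>i=1..n. if k = i then (\<Sum>j=1..n. if l = j then t (i, j) else 0) else 0)"
    unfolding p sum_fun_apply
  proof (intro sum.cong refl)
    fix i
    show "(\<Sum>j=1..n. fscale (t (i, j)) (tensor (simple_root i) (simple_root j)) (k, l)) =
          (if k = i then (\<Sum>j=1..n. if l = j then t (i, j) else 0) else 0)"
      by (cases "k = i")
         (auto simp: fscale_def tensor_def simple_root_def if_distrib cong: if_cong)
  qed
  also have "\<dots> = t p"
    using assms unfolding p by (auto simp: tensor_space_def sum.delta')
  finally show "t p = ?r p" by simp
qed

lemma tensor_lift_linear:
  assumes "vector_space sc"
  shows "Vector_Spaces.linear fscale sc (tensor_lift n sc f)"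
proof -
  interpret X: vector_space sc by (rule assms)
  show ?thesis
    by unfold_locales
       (auto simp: tensor_lift_def fscale_def X.scale_left_distrib sum.distrib X.scale_sum_right)
qed

lemma tensor_lift_tensor:
  assumes "vector_space sc"
    and "\<And>u u' v. u \<in> root_space n \<Longrightarrow> u' \<in> root_space n \<Longrightarrow> v \<in> root_space n \<Longrightarrow>
           f (u + u') v = f u v + f u' v"
    and "\<And>u v v'. u \<in> root_space n \<Longrightarrow> v \<in> root_space n \<Longrightarrow> v' \<in> root_space n \<Longrightarrow>
           f u (v + v') = f u v + f u v'"
    and "\<And>r u v. u \<in> root_space n \<Longrightarrow> v \<in> root_space n \<Longrightarrow> f (fscale r u) v = sc r (f u v)"
    and "\<And>r u v. u \<in> root_space n \<Longrightarrow> v \<in> root_space n \<Longrightarrow> f u (fscale r v) = sc r (f u v)"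
    and u: "u \<in> root_space n" and v: "v \<in> root_space n"
  shows "tensor_lift n sc f (tensor u v) = f u v"
proof -
  interpret X: vector_space sc by (rule assms)
  have root: "simple_root i \<in> root_space n" if "i \<in> {1..n}" for i
    using that by (auto simp: root_space_def simple_root_def)
  have zero: "0 \<in> root_space n" and
    add: "\<And>x y. x \<in> root_space n \<Longrightarrow> y \<in> root_space n \<Longrightarrow> x + y \<in> root_space n" and
    scale: "\<And>r x. x \<in> root_space n \<Longrightarrow> fscale r x \<in> root_space n"
    by (auto simp: root_space_def fscale_def)
  have f0: "f 0 y = 0" "f y 0 = 0" if "y \<in> root_space n" for y
    using assms(2)[of 0 0 y] assms(3)[of y 0 0] zero that by auto
  have L: "(\<Sum>i\<in>I. fscale (c i) (simple_root i)) \<in> root_space n \<and>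
           f (\<Sum>i\<in>I. fscale (c i) (simple_root i)) y = (\<Sum>i\<in>I. sc (c i) (f (simple_root i) y))"
    if "finite I" "I \<subseteq> {1..n}" "y \<in> root_space n" for I c y
    using that
  proof (induction I rule: finite_induct)
    case empty
    then show ?case using zero f0 unfolding sum.empty by blast
  next
    case (insert i I)
    then have i: "simple_root i \<in> root_space n" using root by auto
    have y: "y \<in> root_space n" and I: "I \<subseteq> {1..n}" using insert by auto
    note L1 = conjunct1[OF insert(3)[OF I y]] and L2 = conjunct2[OF insert(3)[OF I y]]
    show ?case
      unfolding sum.insert[OF insert(1,2)] assms(2)[OF scale[OF i] L1 y] assms(4)[OF i y] L2
      using add[OF scale[OF i] L1] by blast
  qed
  have R: "(\<Sum>i\<in>I. fscale (c i) (simple_root i)) \<in> root_space n \<and>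
           f y (\<Sum>i\<in>I. fscale (c i) (simple_root i)) = (\<Sum>i\<in>I. sc (c i) (f y (simple_root i)))"
    if "finite I" "I \<subseteq> {1..n}" "y \<in> root_space n" for I c y
    using that
  proof (induction I rule: finite_induct)
    case empty
    then show ?case using zero f0 unfolding sum.empty by blast
  next
    case (insert i I)
    then have i: "simple_root i \<in> root_space n" using root by auto
    have y: "y \<in> root_space n" and I: "I \<subseteq> {1..n}" using insert by auto
    note L1 = conjunct1[OF insert(3)[OF I y]] and L2 = conjunct2[OF insert(3)[OF I y]]
    show ?case
      unfolding sum.insert[OF insert(1,2)] assms(3)[OF y scale[OF i] L1] assms(5)[OF y i] L2
      using add[OF scale[OF i] L1] by blast
  qed
  have "f u v = (\<Sum>i=1..n. sc (u i) (f (simple_root i) v))"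
    using L[of "{1..n}" v u] v root_space_expand[OF u] by simp
  also have "\<dots> = (\<Sum>i=1..n. sc (u i) (\<Sum>j=1..n. sc (v j) (f (simple_root i) (simple_root j))))"
    using R[of "{1..n}" _ v] root root_space_expand[OF v] by (intro sum.cong) auto
  also have "\<dots> = tensor_lift n sc f (tensor u v)"
    by (simp add: tensor_lift_def tensor_def X.scale_sum_right)
  finally show ?thesis by simp
qed

lemma tensor_lift_unique:
  assumes "vector_space sc"
    and add: "\<And>s t. s \<in> tensor_space n \<Longrightarrow> t \<in> tensor_space n \<Longrightarrow> g (s + t) = g s + g t"
    and scale: "\<And>r t. t \<in> tensor_space n \<Longrightarrow> g (fscale r t) = sc r (g t)"
    and g: "\<And>u v. u \<in> root_space n \<Longrightarrow> v \<in> root_space n \<Longrightarrow> g (tensor u v) = f u v"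
    and t: "t \<in> tensor_space n"
  shows "g t = tensor_lift n sc f t"
proof -
  have zero: "0 \<in> tensor_space n" and
    plus: "\<And>s t. s \<in> tensor_space n \<Longrightarrow> t \<in> tensor_space n \<Longrightarrow> s + t \<in> tensor_space n" and
    scl: "\<And>r t. t \<in> tensor_space n \<Longrightarrow> fscale r t \<in> tensor_space n"
    by (auto simp: tensor_space_def fscale_def)
  have g0: "g 0 = 0" using add[OF zero zero] by simp
  have sum: "(\<Sum>i\<in>I. h i) \<in> tensor_space n \<and> g (\<Sum>i\<in>I. h i) = (\<Sum>i\<in>I. g (h i))"
    if "finite I" "\<And>i. i \<in> I \<Longrightarrow> h i \<in> tensor_space n" for I :: "nat set" and h
    using that by (induction I rule: finite_induct) (auto simp: zero g0 plus add)
  have root: "simple_root i \<in> root_space n" if "i \<in> {1..n}" for i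
    using that by (auto simp: root_space_def simple_root_def)
  let ?e = "\<lambda>i j. tensor (simple_root i) (simple_root j)"
  have e: "?e i j \<in> tensor_space n" if "i \<in> {1..n}" "j \<in> {1..n}" for i j
    using that root tensor_in_tensor_space by blast
  have "g t = g (\<Sum>i=1..n. \<Sum>j=1..n. fscale (t (i, j)) (?e i j))"
    using tensor_space_expand[OF t] by simp
  also have "\<dots> = (\<Sum>i=1..n. g (\<Sum>j=1..n. fscale (t (i, j)) (?e i j)))"
    by (rule conjunct2[OF sum], simp) (rule conjunct1[OF sum], auto intro!: scl e)
  also have "\<dots> = (\<Sum>i=1..n. \<Sum>j=1..n. g (fscale (t (i, j)) (?e i j)))"
    by (intro sum.cong refl conjunct2[OF sum] scl e) auto
  also have "\<dots> = tensor_lift n sc f t"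
    unfolding tensor_lift_def
  proof (rule sum.cong[OF refl], rule sum.cong[OF refl])
    fix i j assume i: "i \<in> {1..n}" and j: "j \<in> {1..n}"
    show "g (fscale (t (i, j)) (?e i j)) = sc (t (i, j)) (f (simple_root i) (simple_root j))"
      unfolding scale[OF e[OF i j]] g[OF root[OF i] root[OF j]] ..
  qed
  finally show ?thesis .
qed

definition tensor_swap :: "nat \<Rightarrow> (nat \<times> nat \<Rightarrow> 'f::field) \<Rightarrow> nat \<times> nat \<Rightarrow> 'f" where
  "tensor_swap n = tensor_lift n fscale (\<lambda>u v. tensor v u)"

definition form_linear ::
    "nat \<Rightarrow> ((nat \<Rightarrow> 'f::field) \<Rightarrow> (nat \<Rightarrow> 'f) \<Rightarrow> 'f) \<Rightarrow> (nat \<times> nat \<Rightarrow> 'f) \<Rightarrow> 'f" where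
  "form_linear n B = tensor_lift n (*) B"

definition tensor_form ::
    "nat \<Rightarrow> ((nat \<Rightarrow> 'f::field) \<Rightarrow> (nat \<Rightarrow> 'f) \<Rightarrow> 'f) \<Rightarrow>
     (nat \<times> nat \<Rightarrow> 'f) \<Rightarrow> (nat \<times> nat \<Rightarrow> 'f) \<Rightarrow> 'f" where
  "tensor_form n B s t =
     tensor_lift n (*) (\<lambda>u v. tensor_lift n (*) (\<lambda>u' v'. B u u' * B v v') t) s"

definition tensor_act ::
    "nat \<Rightarrow> (nat \<Rightarrow> nat \<Rightarrow> int) \<Rightarrow> nat list set \<Rightarrow> (nat \<times> nat \<Rightarrow> 'f::field) \<Rightarrow> nat \<times> nat \<Rightarrow> 'f"
  where
  "tensor_act n A w = tensor_lift n fscale (\<lambda>u v. tensor (weyl_act n A w u) (weyl_act n A w v))"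

lemma root_form_bilinear:
  "root_form n A (u + u') v = root_form n A u v + root_form n A u' v"
  "root_form n A u (v + v') = root_form n A u v + root_form n A u v'"
  "root_form n A (fscale r u) v = r * root_form n A u v"
  "root_form n A u (fscale r v) = r * root_form n A u v"
  by (simp_all add: root_form_def fscale_def algebra_simps sum.distrib sum_distrib_left)

lemma weyl_act_linear:
  "weyl_act n A w (u + v) = weyl_act n A w u + weyl_act n A w v"
  "weyl_act n A w (fscale r v) = fscale r (weyl_act n A w v)"
proof -
  have add: "reflection n A i (u + v) = reflection n A i u + reflection n A i v" for i u v
    unfolding reflection_def root_form_bilinear fun_vs.scale_left_distrib by (simp only: add_diff_add)
  have scale: "reflection n A i (fscale r v) = fscale r (reflection n A i v)" for i v
    unfolding reflection_def root_form_bilinear fun_vs.scale_right_diff_distrib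
    by (simp only: fun_vs.scale_scale)
  have "foldr (reflection n A) x (u + v) = foldr (reflection n A) x u + foldr (reflection n A) x v \<and>
        foldr (reflection n A) x (fscale r v) = fscale r (foldr (reflection n A) x v)" for x
    by (induction x) (simp_all only: foldr.simps comp_def id_apply add scale simp_thms)
  then show "weyl_act n A w (u + v) = weyl_act n A w u + weyl_act n A w v"
    and "weyl_act n A w (fscale r v) = fscale r (weyl_act n A w v)"
    unfolding weyl_act_def by (rule conjunct1, rule conjunct2)
qed

lemma tensor_maps_tensor:
  fixes u v u' v' :: "nat \<Rightarrow> 'f::field"
  assumes "u \<in> root_space n" "v \<in> root_space n" "u' \<in> root_space n" "v' \<in> root_space n"
  shows "tensor_swap n (tensor u v) = tensor v u"
    and "form_linear n (root_form n A) (tensor u v) = root_form n A u v"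
    and "tensor_form n (root_form n A) (tensor u v) (tensor u' v') =
           root_form n A u u' * root_form n A v v'"
    and "tensor_act n A w (tensor u v) = tensor (weyl_act n A w u) (weyl_act n A w v)"
proof -
  have self: "vector_space ((*) :: 'f \<Rightarrow> 'f \<Rightarrow> 'f)"
    by unfold_locales (simp_all add: algebra_simps)
  show "tensor_swap n (tensor u v) = tensor v u"
    unfolding tensor_swap_def
    by (rule tensor_lift_tensor[OF fun_vs.vector_space_axioms]; (rule tensor_bilinear assms)?)
  show "form_linear n (root_form n A) (tensor u v) = root_form n A u v"
    unfolding form_linear_def
    by (rule tensor_lift_tensor[OF self]; (rule root_form_bilinear assms)?)
  have inner: "tensor_lift n (*) (\<lambda>x y. root_form n A p x * root_form n A q y) (tensor u' v') =
        root_form n A p u' * root_form n A q v'" for p q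
    by (rule tensor_lift_tensor[OF self])
       (use assms in \<open>simp_all only: root_form_bilinear algebra_simps\<close>)
  show "tensor_form n (root_form n A) (tensor u v) (tensor u' v') =
          root_form n A u u' * root_form n A v v'"
    unfolding tensor_form_def inner
    by (rule tensor_lift_tensor[OF self])
       (use assms in \<open>simp_all only: root_form_bilinear algebra_simps\<close>)
  show "tensor_act n A w (tensor u v) = tensor (weyl_act n A w u) (weyl_act n A w v)"
    unfolding tensor_act_def
    by (rule tensor_lift_tensor[OF fun_vs.vector_space_axioms])
       (use assms in \<open>simp_all only: weyl_act_linear tensor_bilinear\<close>)
qed

definition Sym2 :: "nat \<Rightarrow> (nat \<times> nat \<Rightarrow> 'f::field) set" where
  "Sym2 n = {t \<in> tensor_space n. tensor_swap n t = t}"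

definition Sym2_null ::
    "nat \<Rightarrow> ((nat \<Rightarrow> 'f::field) \<Rightarrow> (nat \<Rightarrow> 'f) \<Rightarrow> 'f) \<Rightarrow> (nat \<times> nat \<Rightarrow> 'f) set" where
  "Sym2_null n B = {t \<in> Sym2 n. form_linear n B t = 0}"

definition virasoro ::
    "nat \<Rightarrow> ((nat \<Rightarrow> 'f::field) \<Rightarrow> (nat \<Rightarrow> 'f) \<Rightarrow> 'f) \<Rightarrow> nat \<times> nat \<Rightarrow> 'f" where
  "virasoro n B = (\<Sum>i=1..n. tensor (dual_basis n B simple_root i) (simple_root i))"

end

theory Submission
  imports Defs
begin

text \<open>
  Call families \<open>x\<close>, \<open>y\<close> of \<open>n\<close> vectors biorthogonal if \<open>B (x i) (y j) = \<delta>\<^sub>i\<^sub>j\<close>. The whole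
  proposition rests on one fact: the tensor \<open>\<Sum>i. x i \<otimes> y i\<close> is the same for all biorthogonal
  pairs (\<open>biorthogonal_tensor_unique\<close>). A biorthogonal family is linearly independent, so by
  counting dimensions it is a basis, and the coefficients in that basis are read off by pairing
  with the dual family: \<open>v = (\<Sum>i. B (x i) v y i)\<close>. Expanding one pair in terms of the other in
  both tensor factors, the same matrix of coefficients appears in each, and the two tensors agree.

  The Virasoro element is the tensor of the simple roots and their dual basis. Any other basis
  with its dual is a biorthogonal pair (independence of the basis); since \<open>B\<close> is symmetric, so
  is a pair with its two families interchanged (symmetry of \<open>\<omega>\<close>); and since the Weyl group acts
  by isometries, so is the image of a pair under a group element (invariance).
  The contraction formula is the basis expansion once more, applied to pure tensors:
  \<open>\<Sum>i. B (x i) u * B (y i) v = B u v\<close>. Applying it to \<open>\<omega>\<close> itself gives the norm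
  \<open>\<Sum>i. B (x i) (y i) = n\<close>, which is nonzero in characteristic zero.
\<close>

section \<open>Bases of the root space\<close>

lemma root_space_subspace: "fun_vs.subspace (root_space n :: (nat \<Rightarrow> 'f::field) set)"
  by (auto simp: fun_vs.subspace_def root_space_def fscale_def)

lemma simple_root_in_root_space: "i \<in> {1..n} \<Longrightarrow> simple_root i \<in> root_space n"
  by (auto simp: root_space_def simple_root_def)

lemma sum_scale_in_root_space:
  assumes "\<And>i. i \<in> I \<Longrightarrow> y i \<in> root_space n"
  shows "(\<Sum>i\<in>I. fscale (c i) (y i)) \<in> root_space n"
  using assms
  by (intro fun_vs.subspace_sum fun_vs.subspace_scale root_space_subspace) auto

text \<open>
  Independence is phrased for indexed families, which makes injectivity part of it. A vector outside the span would extend the family to \<open>n + 1\<close> independent vectors inside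
  the span of the \<open>n\<close> simple roots.
\<close>

lemma independent_family_spans:
  fixes y :: "nat \<Rightarrow> nat \<Rightarrow> 'f::field"
  assumes y: "\<And>i. i \<in> {1..n} \<Longrightarrow> y i \<in> root_space n"
    and indep: "\<And>c i. (\<Sum>i=1..n. fscale (c i) (y i)) = 0 \<Longrightarrow> i \<in> {1..n} \<Longrightarrow> c i = 0"
    and v: "v \<in> root_space n"
  obtains c where "v = (\<Sum>i=1..n. fscale (c i) (y i))"
proof -
  have inj: "inj_on y {1..n}"
  proof (rule inj_onI, rule ccontr)
    fix i j assume ij: "i \<in> {1..n}" "j \<in> {1..n}" "y i = y j" "i \<noteq> j"
    \<comment> \<open>A repeated vector gives the relation \<open>y i - y j = 0\<close>.\<close>
    let ?c = "\<lambda>k. if k = i then 1 else if k = j then -1 else 0 :: 'f"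
    have "(\<Sum>k=1..n. fscale (?c k) (y k)) = (\<Sum>k\<in>{i, j}. fscale (?c k) (y k))"
      using ij by (intro sum.mono_neutral_right) (auto simp: fscale_def fun_eq_iff)
    also have "\<dots> = 0" using ij by (auto simp: fscale_def fun_eq_iff)
    finally have "?c i = 0" by (rule indep) (fact ij(1))
    then show False by simp
  qed
  have ind: "fun_vs.independent (y ` {1..n})"
  proof (rule fun_vs.independent_if_scalars_zero)
    fix f z assume s: "(\<Sum>z\<in>y ` {1..n}. fscale (f z) z) = 0" and z: "z \<in> y ` {1..n}"
    have "(\<Sum>i=1..n. fscale (f (y i)) (y i)) = 0"
      using s sum.reindex[OF inj, of "\<lambda>z. fscale (f z) z"] by (simp add: o_def)
    from indep[OF this] show "f z = 0" using z by auto
  qed simp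
  have span_roots: "fun_vs.span (simple_root ` {1..n}) = (root_space n :: (nat \<Rightarrow> 'f) set)"
    using simple_root_is_basis unfolding is_basis_def by blast
  have "v \<in> fun_vs.span (y ` {1..n})"
  proof (rule ccontr)
    assume nv: "v \<notin> fun_vs.span (y ` {1..n})"
    with ind have "fun_vs.independent (insert v (y ` {1..n}))"
      by (simp add: fun_vs.independent_insert)
    moreover have "insert v (y ` {1..n}) \<subseteq> fun_vs.span (simple_root ` {1..n})"
      unfolding span_roots using v y by auto
    ultimately have "card (insert v (y ` {1..n})) \<le> card (simple_root ` {1..n} :: (nat \<Rightarrow> 'f) set)"
      using fun_vs.independent_span_bound[of "simple_root ` {1..n}"] by blast
    also have "\<dots> \<le> n" using card_image_le[of "{1..n}" "simple_root :: nat \<Rightarrow> nat \<Rightarrow> 'f"] by simp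
    finally have "card (insert v (y ` {1..n})) \<le> n" .
    moreover have "v \<notin> y ` {1..n}" using nv fun_vs.span_base by blast
    ultimately show False using card_image[OF inj] by simp
  qed
  then obtain f where "v = (\<Sum>z\<in>y ` {1..n}. fscale (f z) z)"
    by (auto simp: fun_vs.span_finite)
  then have "v = (\<Sum>i=1..n. fscale (f (y i)) (y i))"
    using sum.reindex[OF inj, of "\<lambda>z. fscale (f z) z"] by (simp add: o_def)
  then show ?thesis by (rule that)
qed

section \<open>Linearity of the form and of the tensor maps\<close>

lemma root_form_zero: "root_form n A 0 v = 0" "root_form n A v 0 = 0"
  by (simp_all add: root_form_def)

lemma root_form_sum:
  "root_form n A (\<Sum>i\<in>I. fscale (c i) (y i)) v = (\<Sum>i\<in>I. c i * root_form n A (y i) v)"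
  "root_form n A v (\<Sum>i\<in>I. fscale (c i) (y i)) = (\<Sum>i\<in>I. c i * root_form n A v (y i))"
  by (induction I rule: infinite_finite_induct)
     (simp_all only: sum.infinite sum.empty sum.insert root_form_bilinear root_form_zero not_False_eq_True)

lemma tensor_sum:
  "tensor (\<Sum>i\<in>I. y i) v = (\<Sum>i\<in>I. tensor (y i) v)"
  "tensor v (\<Sum>i\<in>I. y i) = (\<Sum>i\<in>I. tensor v (y i))"
  by (auto simp: tensor_def fun_eq_iff sum_fun_apply sum_distrib_left sum_distrib_right)

lemma tensor_lift_sum:
  assumes "vector_space sc"
  shows "tensor_lift n sc f (\<Sum>i\<in>I. t i) = (\<Sum>i\<in>I. tensor_lift n sc f (t i))"
proof -
  interpret Vector_Spaces.linear fscale sc "tensor_lift n sc f"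
    by (rule tensor_lift_linear[OF assms])
  show ?thesis by (rule sum)
qed

lemma vector_space_self: "vector_space ((*) :: 'f::field \<Rightarrow> 'f \<Rightarrow> 'f)"
  by unfold_locales (simp_all add: algebra_simps)

lemma tensor_maps_sum:
  "tensor_swap n (\<Sum>i\<in>I. t i) = (\<Sum>i\<in>I. tensor_swap n (t i))"
  "tensor_act n A w (\<Sum>i\<in>I. t i) = (\<Sum>i\<in>I. tensor_act n A w (t i))"
  "form_linear n B (\<Sum>i\<in>I. t i) = (\<Sum>i\<in>I. form_linear n B (t i))"
  "tensor_form n B (\<Sum>i\<in>I. t i) s = (\<Sum>i\<in>I. tensor_form n B (t i) s)"
  unfolding tensor_swap_def tensor_act_def form_linear_def tensor_form_def
  by (rule tensor_lift_sum, rule vector_space_self fun_vs.vector_space_axioms)+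

lemma tensor_maps_pure:
  assumes "u \<in> root_space n" "v \<in> root_space n"
  shows "tensor_swap n (tensor u v) = tensor v u"
    and "form_linear n (root_form n A) (tensor u v) = root_form n A u v"
    and "tensor_act n A w (tensor u v) = tensor (weyl_act n A w u) (weyl_act n A w v)"
  using tensor_maps_tensor[OF assms assms] by auto

lemma tensor_form_linear_right:
  "tensor_form n B t (s + s') = tensor_form n B t s + tensor_form n B t s'"
  "tensor_form n B t (fscale r s) = r * tensor_form n B t s"
  by (simp_all add: tensor_form_def tensor_lift_def fscale_def algebra_simps sum.distrib
      sum_distrib_left)

section \<open>Biorthogonal families\<close>

locale nondegenerate_root_form =
  fixes n :: nat and A :: "nat \<Rightarrow> nat \<Rightarrow> int" and B :: "(nat \<Rightarrow> 'f::field) \<Rightarrow> (nat \<Rightarrow> 'f) \<Rightarrow> 'f"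
  defines "B \<equiv> root_form n A"
  assumes A_sym: "i \<in> {1..n} \<Longrightarrow> j \<in> {1..n} \<Longrightarrow> A i j = A j i"
    and nondegenerate: "nondegenerate n B"
begin

lemma B_sym: "B u v = B v u"
  unfolding B_def root_form_def
  by (subst sum.swap, intro sum.cong refl) (simp add: A_sym mult.commute)

lemma B_zero: "B 0 v = 0" "B v 0 = 0"
  by (simp_all add: B_def root_form_zero)

lemma B_sum:
  "B (\<Sum>i\<in>I. fscale (c i) (y i)) v = (\<Sum>i\<in>I. c i * B (y i) v)"
  "B v (\<Sum>i\<in>I. fscale (c i) (y i)) = (\<Sum>i\<in>I. c i * B v (y i))"
  unfolding B_def by (rule root_form_sum)+

definition biorthogonal :: "(nat \<Rightarrow> nat \<Rightarrow> 'f) \<Rightarrow> (nat \<Rightarrow> nat \<Rightarrow> 'f) \<Rightarrow> bool" where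
  "biorthogonal x y \<longleftrightarrow>
     (\<forall>i\<in>{1..n}. x i \<in> root_space n \<and> y i \<in> root_space n) \<and>
     (\<forall>i\<in>{1..n}. \<forall>j\<in>{1..n}. B (x i) (y j) = (if i = j then 1 else 0))"

lemma biorthogonal_commute: "biorthogonal x y \<Longrightarrow> biorthogonal y x"
  using B_sym unfolding biorthogonal_def by auto

text \<open>
  Pairing a combination of the \<open>y j\<close> with \<open>x i\<close> extracts its \<open>i\<close>-th coefficient. This gives
  independence of \<open>y\<close>, hence spanning, and then identifies the coefficients of \<open>v\<close>.
\<close>

lemma biorthogonal_expand:
  assumes xy: "biorthogonal x y" and v: "v \<in> root_space n"
  shows "v = (\<Sum>i=1..n. fscale (B (x i) v) (y i))"
proof -
  have coeff: "B (x i) (\<Sum>j=1..n. fscale (c j) (y j)) = c i" if "i \<in> {1..n}" for c i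
  proof -
    have "B (x i) (\<Sum>j=1..n. fscale (c j) (y j)) = (\<Sum>j=1..n. if i = j then c j else 0)"
      unfolding B_sum using xy that by (intro sum.cong) (auto simp: biorthogonal_def)
    then show ?thesis using that by simp
  qed
  obtain c where c: "v = (\<Sum>j=1..n. fscale (c j) (y j))"
  proof (rule independent_family_spans[of n y v])
    show "y i \<in> root_space n" if "i \<in> {1..n}" for i
      using xy that by (auto simp: biorthogonal_def)
    show "c i = 0" if "(\<Sum>i=1..n. fscale (c i) (y i)) = 0" "i \<in> {1..n}" for c i
      using coeff[OF that(2), of c] that(1) by (simp add: B_zero)
  qed (use v in blast)+
  have "B (x i) v = c i" if "i \<in> {1..n}" for i
    using coeff[OF that] c by simp
  then have "(\<Sum>i=1..n. fscale (B (x i) v) (y i)) = (\<Sum>i=1..n. fscale (c i) (y i))"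
    by (intro sum.cong) auto
  then show ?thesis using c by simp
qed

text \<open>
  With \<open>g i j = B (x i) (y' j)\<close>, the expansions are \<open>y' j = (\<Sum>i. g i j y i)\<close> and
  \<open>x i = (\<Sum>j. g i j x' j)\<close>, so both tensors equal \<open>\<Sum>i j. g i j x' j \<otimes> y i\<close>.
\<close>

lemma biorthogonal_tensor_unique:
  assumes xy: "biorthogonal x y" and xy': "biorthogonal x' y'"
  shows "(\<Sum>i=1..n. tensor (x i) (y i)) = (\<Sum>j=1..n. tensor (x' j) (y' j))"
proof -
  let ?g = "\<lambda>i j. B (x i) (y' j)"
  have y': "y' j = (\<Sum>i=1..n. fscale (?g i j) (y i))" if "j \<in> {1..n}" for j
    using biorthogonal_expand[OF xy] xy' that by (auto simp: biorthogonal_def)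
  have x: "x i = (\<Sum>j=1..n. fscale (?g i j) (x' j))" if "i \<in> {1..n}" for i
    using biorthogonal_expand[OF biorthogonal_commute[OF xy'], of "x i"] xy that B_sym
    by (auto simp: biorthogonal_def)
  have "(\<Sum>i=1..n. tensor (x i) (y i)) =
        (\<Sum>i=1..n. \<Sum>j=1..n. fscale (?g i j) (tensor (x' j) (y i)))"
  proof (rule sum.cong[OF refl])
    fix i assume "i \<in> {1..n}"
    from arg_cong[OF x[OF this], of "\<lambda>z. tensor z (y i)"]
    show "tensor (x i) (y i) = (\<Sum>j=1..n. fscale (?g i j) (tensor (x' j) (y i)))"
      unfolding tensor_sum tensor_bilinear .
  qed
  also have "\<dots> = (\<Sum>j=1..n. \<Sum>i=1..n. fscale (?g i j) (tensor (x' j) (y i)))"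
    by (rule sum.swap)
  also have "\<dots> = (\<Sum>j=1..n. tensor (x' j) (y' j))"
  proof (rule sum.cong[OF refl])
    fix j assume "j \<in> {1..n}"
    from arg_cong[OF y'[OF this], of "tensor (x' j)"]
    show "(\<Sum>i=1..n. fscale (?g i j) (tensor (x' j) (y i))) = tensor (x' j) (y' j)"
      unfolding tensor_sum tensor_bilinear by (rule sym)
  qed
  finally show ?thesis .
qed

text \<open>
  A vector orthogonal to a basis is orthogonal to its span, which is the whole space. This gives
  the uniqueness of dual vectors and, through the independence of the rows of a linear system,
  also their existence.
\<close>

lemma orthogonal_to_basis:
  assumes b: "is_basis n b" and u: "u \<in> root_space n"
    and orth: "\<And>j. j \<in> {1..n} \<Longrightarrow> B u (b j) = 0"
  shows "u = 0"
proof -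
  have "B u v = 0" if "v \<in> root_space n" for v
  proof -
    have "v \<in> fun_vs.span (b ` {1..n})" using that b by (simp add: is_basis_def)
    then obtain f where "v = (\<Sum>z\<in>b ` {1..n}. fscale (f z) z)"
      by (auto simp: fun_vs.span_finite)
    then show ?thesis using orth by (auto simp: B_sum intro!: sum.neutral)
  qed
  then show ?thesis using nondegenerate u unfolding nondegenerate_def by blast
qed

text \<open>
  A dual vector solves a linear system whose \<open>i\<close>-th row consists of the values
  \<open>B (simple_root i) (b j)\<close>. Nondegeneracy makes the rows independent; they therefore span, and a
  combination of rows equal to a unit vector is a combination of simple roots dual to it.
\<close>

lemma dual_vector_exists:
  assumes b: "is_basis n b" and i: "i \<in> {1..n}"
  obtains x where "x \<in> root_space n" "\<And>j. j \<in> {1..n} \<Longrightarrow> B x (b j) = (if i = j then 1 else 0)"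
proof -
  define r where "r k = (\<lambda>j. if j \<in> {1..n} then B (simple_root k) (b j) else 0)" for k
  have comb: "(\<Sum>k=1..n. fscale (c k) (r k)) j = B (\<Sum>k=1..n. fscale (c k) (simple_root k)) (b j)"
    if "j \<in> {1..n}" for c j
    using that unfolding B_sum by (simp add: sum_fun_apply fscale_def r_def)
  obtain c where c: "simple_root i = (\<Sum>k=1..n. fscale (c k) (r k))"
  proof (rule independent_family_spans[of n r "simple_root i"])
    show "r k \<in> root_space n" for k by (simp add: r_def root_space_def)
    show "c k = 0" if zero: "(\<Sum>k=1..n. fscale (c k) (r k)) = 0" and k: "k \<in> {1..n}" for c k
    proof -
      let ?u = "\<Sum>k=1..n. fscale (c k) (simple_root k)"
      have "?u = 0"
      proof (rule orthogonal_to_basis[OF b])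
        show "?u \<in> root_space n"
          by (intro sum_scale_in_root_space simple_root_in_root_space)
        show "B ?u (b j) = 0" if "j \<in> {1..n}" for j
          using comb[OF that, of c] zero by simp
      qed
      then have "?u k = 0" by simp
      then show ?thesis
        using k by (simp add: sum_fun_apply fscale_def simple_root_def if_distrib cong: if_cong)
    qed
    show "simple_root i \<in> root_space n" using i by (rule simple_root_in_root_space)
  qed blast
  show ?thesis
  proof (rule that)
    show "(\<Sum>k=1..n. fscale (c k) (simple_root k)) \<in> root_space n"
      by (intro sum_scale_in_root_space simple_root_in_root_space)
    show "B (\<Sum>k=1..n. fscale (c k) (simple_root k)) (b j) = (if i = j then 1 else 0)"
      if "j \<in> {1..n}" for j
      unfolding comb[OF that, symmetric] c[symmetric] by (simp add: simple_root_def eq_commute)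
  qed
qed

lemma dual_basis_biorthogonal:
  assumes b: "is_basis n b"
  shows "biorthogonal (dual_basis n B b) b"
proof -
  have "dual_basis n B b i \<in> root_space n \<and>
        (\<forall>j\<in>{1..n}. B (dual_basis n B b i) (b j) = (if i = j then 1 else 0))"
    if i: "i \<in> {1..n}" for i
  proof -
    obtain x where x: "x \<in> root_space n"
      "\<And>j. j \<in> {1..n} \<Longrightarrow> B x (b j) = (if i = j then 1 else 0)"
      using dual_vector_exists[OF b i] by blast
    have "\<exists>!x. x \<in> root_space n \<and> (\<forall>j\<in>{1..n}. B x (b j) = (if i = j then 1 else 0))"
    proof (rule ex1I[of _ x])
      show "x \<in> root_space n \<and> (\<forall>j\<in>{1..n}. B x (b j) = (if i = j then 1 else 0))"
        using x by blast
      fix z assume z: "z \<in> root_space n \<and> (\<forall>j\<in>{1..n}. B z (b j) = (if i = j then 1 else 0))"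
      have "B (z - x) (b j) = 0" if "j \<in> {1..n}" for j
        using root_form_minus_scale[of n A "b j" z 1 x] x(2)[OF that] z that B_sym
        by (simp add: B_def)
      then have "z - x = 0"
        using x z by (intro orthogonal_to_basis[OF b] fun_vs.subspace_diff root_space_subspace) auto
      then show "z = x" by simp
    qed
    from theI'[OF this] show ?thesis unfolding dual_basis_def .
  qed
  moreover have "b i \<in> root_space n" if "i \<in> {1..n}" for i
    using b that fun_vs.span_base[of "b i" "b ` {1..n}"] by (simp add: is_basis_def)
  ultimately show ?thesis unfolding biorthogonal_def by blast
qed

section \<open>The Virasoro element\<close>

lemma virasoro_eq_biorthogonal_tensor:
  assumes "biorthogonal x y"
  shows "virasoro n B = (\<Sum>i=1..n. tensor (x i) (y i))"
  unfolding virasoro_def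
  by (rule biorthogonal_tensor_unique[OF dual_basis_biorthogonal[OF simple_root_is_basis] assms])

lemma biorthogonal_contraction:
  assumes "biorthogonal x y" "u \<in> root_space n"
  shows "(\<Sum>i=1..n. B (x i) u * B (y i) v) = B u v"
  using arg_cong[OF biorthogonal_expand[OF assms], of "\<lambda>z. B z v"] by (simp add: B_sum)

text \<open>
  Both sides are linear in \<open>t\<close>, so the contraction formula on pure tensors decides the matter.
\<close>

lemma tensor_form_virasoro:
  assumes "t \<in> tensor_space n"
  shows "tensor_form n B (virasoro n B) t = form_linear n B t"
  unfolding form_linear_def
proof (rule tensor_lift_unique[OF vector_space_self _ _ _ assms])
  let ?d = "dual_basis n B simple_root"
  have d: "biorthogonal ?d simple_root" by (rule dual_basis_biorthogonal[OF simple_root_is_basis])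
  fix u v :: "nat \<Rightarrow> 'f" assume uv: "u \<in> root_space n" "v \<in> root_space n"
  have "tensor_form n B (virasoro n B) (tensor u v) = (\<Sum>i=1..n. B (?d i) u * B (simple_root i) v)"
    unfolding virasoro_def tensor_maps_sum
    using d uv by (intro sum.cong) (auto simp: B_def biorthogonal_def tensor_maps_tensor)
  also have "\<dots> = B u v" by (rule biorthogonal_contraction[OF d uv(1)])
  finally show "tensor_form n B (virasoro n B) (tensor u v) = B u v" .
qed (rule tensor_form_linear_right)+

lemma tensor_swap_virasoro: "tensor_swap n (virasoro n B) = virasoro n B"
proof -
  have d: "biorthogonal (dual_basis n B simple_root) simple_root"
    by (rule dual_basis_biorthogonal[OF simple_root_is_basis])
  have "tensor_swap n (virasoro n B) =
        (\<Sum>i=1..n. tensor (simple_root i) (dual_basis n B simple_root i))"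
    unfolding virasoro_def tensor_maps_sum
    using d by (intro sum.cong) (auto simp: biorthogonal_def tensor_maps_pure)
  also have "\<dots> = virasoro n B"
    by (rule virasoro_eq_biorthogonal_tensor[OF biorthogonal_commute[OF d], symmetric])
  finally show ?thesis .
qed

lemma virasoro_in_tensor_space: "virasoro n B \<in> tensor_space n"
proof -
  have "biorthogonal (dual_basis n B simple_root) simple_root"
    by (rule dual_basis_biorthogonal[OF simple_root_is_basis])
  then have "tensor (dual_basis n B simple_root i) (simple_root i) \<in> tensor_space n"
    if "i \<in> {1..n}" for i
    using that by (auto simp: biorthogonal_def tensor_in_tensor_space)
  then show ?thesis
    by (auto simp: virasoro_def tensor_space_def sum_fun_apply intro!: sum.neutral)
qed

lemma form_linear_virasoro: "form_linear n B (virasoro n B) = of_nat n"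
proof -
  have d: "biorthogonal (dual_basis n B simple_root) simple_root"
    by (rule dual_basis_biorthogonal[OF simple_root_is_basis])
  have "form_linear n B (virasoro n B) = (\<Sum>i=1..n. B (dual_basis n B simple_root i) (simple_root i))"
    unfolding virasoro_def tensor_maps_sum
    using d by (intro sum.cong) (auto simp: B_def biorthogonal_def tensor_maps_pure)
  also have "\<dots> = (\<Sum>i=1..n. 1)"
    using d by (intro sum.cong) (auto simp: biorthogonal_def)
  finally show ?thesis by simp
qed

lemma virasoro_eq_half_vee:
  assumes "(2 :: 'f) \<noteq> 0"
  shows "virasoro n B = fscale (1 / 2) (\<Sum>i=1..n. vee (dual_basis n B simple_root i) (simple_root i))"
proof -
  have "biorthogonal (dual_basis n B simple_root) simple_root"
    by (rule dual_basis_biorthogonal[OF simple_root_is_basis])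
  from virasoro_eq_biorthogonal_tensor[OF this]
    virasoro_eq_biorthogonal_tensor[OF biorthogonal_commute[OF this]]
  have "(\<Sum>i=1..n. vee (dual_basis n B simple_root i) (simple_root i)) = virasoro n B + virasoro n B"
    by (simp add: vee_def sum.distrib)
  then show ?thesis using assms by (simp add: fscale_def fun_eq_iff flip: mult_2)
qed

section \<open>Invariance under the Weyl group\<close>

text \<open>
  A reflection is an isometry because its root has norm 2: in
  \<open>B (u - B \<alpha> u \<alpha>) (v - B \<alpha> v \<alpha>)\<close> the two cross terms cancel \<open>B \<alpha> u * B \<alpha> v * B \<alpha> \<alpha>\<close>.
\<close>

lemma reflection_isometry:
  assumes "A i i = 2" "i \<in> {1..n}"
  shows "B (reflection n A i u) (reflection n A i v) = B u v"
proof -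
  have diff: "B w (u - fscale r v) = B w u - r * B w v" for w u v r
    unfolding B_def by (rule root_form_minus_scale)
  have norm: "B (simple_root i) (simple_root i) = 2"
    unfolding B_def using root_form_simple_roots[OF assms(2,2), of A] assms(1) by simp
  show ?thesis
    unfolding reflection_def B_def[symmetric] diff B_sym[of "u - _"] norm
    using B_sym[of u v] B_sym[of u "simple_root i"] B_sym[of v "simple_root i"]
    by (simp add: diff norm algebra_simps)
qed

lemma weyl_act_isometry:
  assumes diag: "\<And>i. i \<in> {1..n} \<Longrightarrow> A i i = 2" and w: "w \<in> carrier (weyl_group n A)"
  shows "B (weyl_act n A w u) (weyl_act n A w v) = B u v"
    and "v \<in> root_space n \<Longrightarrow> weyl_act n A w v \<in> root_space n"
proof -
  obtain ls where ls: "ls \<in> lists {1..n}" "w = weyl_class n A ls"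
    using w by (auto simp: weyl_group_carrier)
  have act: "weyl_act n A w = (foldr (reflection n A) ls :: (nat \<Rightarrow> 'f) \<Rightarrow> _)"
    unfolding ls(2) by (rule weyl_act_class[OF diag A_sym ls(1)])
  show "B (weyl_act n A w u) (weyl_act n A w v) = B u v"
    unfolding act using ls(1) by (induction ls) (auto simp: reflection_isometry diag)
  show "weyl_act n A w v \<in> root_space n" if "v \<in> root_space n"
    unfolding act using ls(1) that
    by (induction ls)
       (auto simp: reflection_def intro!: fun_vs.subspace_diff fun_vs.subspace_scale
          root_space_subspace simple_root_in_root_space)
qed

lemma tensor_act_virasoro:
  assumes diag: "\<And>i. i \<in> {1..n} \<Longrightarrow> A i i = 2" and w: "w \<in> carrier (weyl_group n A)"
  shows "tensor_act n A w (virasoro n B) = virasoro n B"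
proof -
  let ?d = "dual_basis n B simple_root" and ?g = "weyl_act n A w"
  have d: "biorthogonal ?d simple_root" by (rule dual_basis_biorthogonal[OF simple_root_is_basis])
  then have gd: "biorthogonal (\<lambda>i. ?g (?d i)) (\<lambda>i. ?g (simple_root i))"
    unfolding biorthogonal_def using weyl_act_isometry[OF diag w] by simp
  have "tensor_act n A w (virasoro n B) = (\<Sum>i=1..n. tensor (?g (?d i)) (?g (simple_root i)))"
    unfolding virasoro_def tensor_maps_sum
    using d by (intro sum.cong) (auto simp: biorthogonal_def tensor_maps_pure)
  also have "\<dots> = virasoro n B" by (rule virasoro_eq_biorthogonal_tensor[OF gd, symmetric])
  finally show ?thesis .
qed

end

section \<open>The three-armed tree\<close>

theorem proposition7p7:
  fixes a b c n :: nat
    and A :: "nat \<Rightarrow> nat \<Rightarrow> int"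
    and B :: "(nat \<Rightarrow> 'f::field_char_0) \<Rightarrow> (nat \<Rightarrow> 'f) \<Rightarrow> 'f"
    and \<omega> :: "nat \<times> nat \<Rightarrow> 'f"
  assumes "a \<ge> 1" and "b \<ge> 1" and "c \<ge> 1"
    and n: "n = a + b + c + 1"
    and A: "A = Y_cartan a b c"
    and B: "B = root_form n A"
    and nondegenerate: "nondegenerate n B"
    and \<omega>: "\<omega> = virasoro n B"
  shows "(\<forall>v \<in> tensor_space n. tensor_form n B \<omega> v = form_linear n B v)
    \<and> (\<forall>\<beta>. is_basis n \<beta> \<longrightarrow> \<omega> = (\<Sum>i=1..n. tensor (dual_basis n B \<beta> i) (\<beta> i)))
    \<and> (tensor_swap n \<omega> = \<omega> \<and>
         \<omega> = fscale (1 / 2) (\<Sum>i=1..n. vee (dual_basis n B simple_root i) (simple_root i)))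
    \<and> (\<forall>w \<in> carrier (weyl_group n A). tensor_act n A w \<omega> = \<omega>)
    \<and> (tensor_form n B \<omega> \<omega> = of_nat n \<and> \<omega> \<in> Sym2 n - Sym2_null n B)"
proof -
  interpret nondegenerate_root_form n A B
    using nondegenerate unfolding B
    by unfold_locales (auto simp: A Y_cartan_sym)
  have diag: "A i i = 2" for i by (simp add: A Y_cartan_diag)
  have "of_nat n \<noteq> (0 :: 'f)" unfolding of_nat_eq_0_iff using n by simp
  then have "\<omega> \<in> Sym2 n - Sym2_null n B"
    unfolding \<omega> Sym2_def Sym2_null_def
    using virasoro_in_tensor_space tensor_swap_virasoro form_linear_virasoro by auto
  moreover have "tensor_form n B \<omega> \<omega> = of_nat n"
    unfolding \<omega> tensor_form_virasoro[OF virasoro_in_tensor_space] by (rule form_linear_virasoro)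
  moreover have "\<omega> = (\<Sum>i=1..n. tensor (dual_basis n B \<beta> i) (\<beta> i))" if "is_basis n \<beta>" for \<beta>
    unfolding \<omega> by (rule virasoro_eq_biorthogonal_tensor[OF dual_basis_biorthogonal[OF that]])
  moreover have "tensor_act n A w \<omega> = \<omega>" if "w \<in> carrier (weyl_group n A)" for w
    unfolding \<omega> by (rule tensor_act_virasoro[OF diag that])
  ultimately show ?thesis
    using tensor_form_virasoro tensor_swap_virasoro virasoro_eq_half_vee unfolding \<omega> by auto
qed

end
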